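(* Let $\mathbb V=\bigoplus_{n\in\mathbb N}\mathbb V(n)$ be graded by a diagonalizable operator $L_0$, and let $A^1(z),\dots,A^M(z)\in\mathrm{End}(\mathbb V)[[z^{\pm1}]]$ be mutually local homogeneous fields. Then for each $v\in\mathbb V$, $v'\in\mathbb V'$ and each permutation $\sigma$ of $\{1,\dots,M\}$, the formal Laurent series $$\big\langle v',A^{\sigma(1)}(z_{\sigma(1)})\cdots A^{\sigma(M)}(z_{\sigma(M)})v\big\rangle\in\mathbb C[[z_1^{\pm1},\dots,z_M^{\pm1}]]$$ converges absolutely and locally uniformly on $$\Omega_\sigma=\{(z_1,\dots,z_M)\in\mathbb C^M:0<|z_{\sigma(M)}|<\cdots<|z_{\sigma(1)}|\}$$ and can be extended to a holomorphic function $f_{v,v'}$ on $\mathrm{Conf}^M(\mathbb C^\times)$ which is independent of $\sigma$. Moreover, there exists $N\in\mathbb N$, the same for all $v,v'$, such that $$f_{v,v'}(z_1,\dots,z_M)\cdot\prod_{1\le i<j\le M}(z_i-z_j)^N$$ is holomorphic on $(\mathbb C^\times)^M$; indeed, it is an element of $\mathbb C[z_1^{\pm1},\dots,z_M^{\pm1}]$.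
   Context: All vector spaces are over $\mathbb C$; $\mathbb C^\times=\mathbb C\setminus\{0\}$; $\mathrm{Conf}^M(X)=\{(x_1,\dots,x_M)\in X^M:x_i\ne x_j\text{ for }i\ne j\}$. $L_0$ acts on $\mathbb V(n)$ as $n$; $\mathbb V(n)$ need not be finite-dimensional. The graded dual is $\mathbb V'=\bigoplus_{n\in\mathbb N}\mathbb V(n)^*$. A homogeneous field on $\mathbb V$ is $A(z)=\sum_{n\in\mathbb Z}A_nz^{-n-1}\in\mathrm{End}(\mathbb V)[[z^{\pm1}]]$ (formal series in all integer powers of $z$) such that for some integer $\Delta_A$ one has $[L_0,A_n]=(\Delta_A-n-1)A_n$ for all $n\in\mathbb Z$. Two homogeneous fields $A(z),B(z)$ are local (formal variable version) if there is $N\in\mathbb N$ with $(z_1-z_2)^N[A(z_1),B(z_2)]=0$ in $\mathrm{End}(\mathbb V)[[z_1^{\pm1},z_2^{\pm1}]]$. Fields $A^1,\dots,A^M$ are mutually local if $A^i$ and $A^j$ are local for all $i\neq j$. The formal series $\langle v',A^{1}(z_{1})\cdots A^{M}(z_{M})v\rangle$ is $\sum_{n_1,\dots,n_M\in\mathbb Z}\langle v',A^1_{n_1}\cdots A^M_{n_M}v\rangle z_1^{-n_1-1}\cdots z_M^{-n_M-1}$. A series of functions $\sum_nf_n$ on a locally compact Hausdorff space $\Omega$ converges absolutely and locally uniformly if every point of $\Omega$ has a neighborhood $U$ with $\sup_{x\in U}\sum_n|f_n(x)|<+\infty$. *)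

theory Defs
  imports "HOL-Analysis.Analysis"
begin

text \<open>The vector space is the whole type \<open>'v\<close>, with an explicit complex scalar multiplication.\<close>

locale graded_vector_space = vector_space smul
  for smul :: "complex \<Rightarrow> 'v::ab_group_add \<Rightarrow> 'v" +
  fixes V :: "nat \<Rightarrow> 'v set"
    and L0 :: "'v \<Rightarrow> 'v"
  assumes subspace_V: "subspace (V n)"
    and direct_sum:
      "\<exists>!c. (\<forall>n. c n \<in> V n) \<and> finite {n. c n \<noteq> 0} \<and> v = (\<Sum>n | c n \<noteq> 0. c n)"
    and linear_L0: "Vector_Spaces.linear smul smul L0"
    and L0_eigen: "x \<in> V n \<Longrightarrow> L0 x = smul (of_nat n) x"

text \<open>An element of \<open>\<Oplus>n. V(n)*\<close> is identified with the linear functional on the whole space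
  that it induces; these are the functionals vanishing on all but finitely many \<open>V(n)\<close>.\<close>

definition graded_dual ::
  "(complex \<Rightarrow> 'v::ab_group_add \<Rightarrow> 'v) \<Rightarrow> (nat \<Rightarrow> 'v set) \<Rightarrow> ('v \<Rightarrow> complex) set" where
  "graded_dual smul V =
     {\<phi>. Vector_Spaces.linear smul (*) \<phi> \<and> finite {n. \<exists>x\<in>V n. \<phi> x \<noteq> 0}}"

text \<open>A series \<open>A(z) = \<Sum>n. A\<^sub>n z^(-n-1)\<close> is given by its modes \<open>n \<mapsto> A\<^sub>n\<close>.\<close>

definition homogeneous_field ::
  "(complex \<Rightarrow> 'v::ab_group_add \<Rightarrow> 'v) \<Rightarrow> ('v \<Rightarrow> 'v) \<Rightarrow> (int \<Rightarrow> 'v \<Rightarrow> 'v) \<Rightarrow> bool" where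
  "homogeneous_field smul L0 A \<longleftrightarrow>
     (\<forall>n. Vector_Spaces.linear smul smul (A n)) \<and>
     (\<exists>\<Delta>::int. \<forall>n v. L0 (A n v) - A n (L0 v) = smul (of_int (\<Delta> - n - 1)) (A n v))"

text \<open>Series in \<open>End(V)[[z\<^sub>1, z\<^sub>1^-1, z\<^sub>2, z\<^sub>2^-1]]\<close> are functions \<open>C\<close>, with \<open>C a b\<close> the coefficient of
  \<open>z\<^sub>1^a z\<^sub>2^b\<close>. Hence \<open>A\<^sub>m\<close> occurs at exponent \<open>a = -m-1\<close>, i.e. \<open>m = -a-1\<close>.\<close>

definition commutator_series ::
  "(int \<Rightarrow> 'v \<Rightarrow> 'v) \<Rightarrow> (int \<Rightarrow> 'v \<Rightarrow> 'v) \<Rightarrow> int \<Rightarrow> int \<Rightarrow> 'v \<Rightarrow> 'v::ab_group_add" where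
  "commutator_series A B a b v = A (-a-1) (B (-b-1) v) - B (-b-1) (A (-a-1) v)"

text \<open>Multiplication of such a series by \<open>z\<^sub>1 - z\<^sub>2\<close>.\<close>

definition mult_z1_minus_z2 ::
  "(int \<Rightarrow> int \<Rightarrow> 'v \<Rightarrow> 'v) \<Rightarrow> int \<Rightarrow> int \<Rightarrow> 'v \<Rightarrow> 'v::ab_group_add" where
  "mult_z1_minus_z2 C a b v = C (a - 1) b v - C a (b - 1) v"

definition local_fields ::
  "(int \<Rightarrow> 'v \<Rightarrow> 'v) \<Rightarrow> (int \<Rightarrow> 'v \<Rightarrow> 'v::ab_group_add) \<Rightarrow> bool" where
  "local_fields A B \<longleftrightarrow>
     (\<exists>N::nat. (mult_z1_minus_z2 ^^ N) (commutator_series A B) = (\<lambda>a b v. 0))"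

text \<open>The index set \<open>{1,\<dots>,M}\<close> is a finite linearly ordered type \<open>'m\<close>. The term of the series
  \<open>\<langle>v', A[\<sigma> 1](z[\<sigma> 1]) \<dots> A[\<sigma> M](z[\<sigma> M]) v\<rangle>\<close> belonging to the mode numbers \<open>n\<close> is indexed by field: \<open>n i\<close> is
  the mode number of the field \<open>A i\<close>, so that the variable \<open>z $ i\<close> has exponent \<open>- n i - 1\<close>.\<close>

definition correlator_term ::
  "('m \<Rightarrow> int \<Rightarrow> 'v \<Rightarrow> 'v) \<Rightarrow> ('m \<Rightarrow> 'm) \<Rightarrow> 'v \<Rightarrow> ('v \<Rightarrow> complex)
     \<Rightarrow> ('m \<Rightarrow> int) \<Rightarrow> complex ^ 'm::{finite,linorder} \<Rightarrow> complex" where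
  "correlator_term A \<sigma> v v' n z =
     v' (foldr (\<lambda>k. A (\<sigma> k) (n (\<sigma> k))) (sorted_list_of_set UNIV) v)
     * (\<Prod>i\<in>UNIV. (z $ i) powi (- n i - 1))"

definition converges_abs_loc_unif_on ::
  "('i \<Rightarrow> 'a::topological_space \<Rightarrow> complex) \<Rightarrow> 'a set \<Rightarrow> bool" where
  "converges_abs_loc_unif_on f \<Omega> \<longleftrightarrow>
     (\<forall>x\<in>\<Omega>. \<exists>U. openin (top_of_set \<Omega>) U \<and> x \<in> U \<and>
        (\<forall>y\<in>U. (\<lambda>n. norm (f n y)) summable_on UNIV) \<and>
        bdd_above ((\<lambda>y. \<Sum>\<^sub>\<infinity>n. norm (f n y)) ` U))"

definition Omega :: "('m \<Rightarrow> 'm) \<Rightarrow> (complex ^ 'm::{finite,linorder}) set" where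
  "Omega \<sigma> = {z. (\<forall>i. 0 < norm (z $ i)) \<and>
                  (\<forall>i j. i < j \<longrightarrow> norm (z $ \<sigma> j) < norm (z $ \<sigma> i))}"

definition Conf :: "'a set \<Rightarrow> ('a ^ 'm) set" where
  "Conf X = {z. (\<forall>i. z $ i \<in> X) \<and> (\<forall>i j. i \<noteq> j \<longrightarrow> z $ i \<noteq> z $ j)}"

definition punctured_space :: "(complex ^ 'm) set" where
  "punctured_space = {z. \<forall>i. z $ i \<noteq> 0}"

text \<open>Holomorphy in several variables, used for open \<open>S\<close> only: existence of a complex-linear
  total derivative at each point.\<close>

definition holomorphic_several_on ::
  "(complex ^ 'm \<Rightarrow> complex) \<Rightarrow> (complex ^ 'm) set \<Rightarrow> bool" where
  "holomorphic_several_on f S \<longleftrightarrow>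
     (\<forall>z\<in>S. \<exists>D. (f has_derivative D) (at z within S) \<and> (\<forall>c w. D (c *s w) = c * D w))"

definition laurent_polynomial_fun :: "(complex ^ 'm \<Rightarrow> complex) \<Rightarrow> bool" where
  "laurent_polynomial_fun g \<longleftrightarrow>
     (\<exists>(K :: ('m \<Rightarrow> int) set) c. finite K \<and>
        (\<forall>z\<in>punctured_space. g z = (\<Sum>k\<in>K. c k * (\<Prod>i\<in>UNIV. (z $ i) powi (k i)))))"

end

theory Submission
  imports Defs
begin

text \<open>Write a correlator as the function \<open>C xs\<close> sending a multi-exponent \<open>a\<close> to the coefficient of \<open>\<Prod>z\<^sub>i^a\<^sub>i\<close>,
where the list \<open>xs\<close> gives the order in which the fields are multiplied. The series is infinite in both
directions, so no product of two such series is ever formed; the only operation used is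
multiplication by a difference \<open>z\<^sub>i - z\<^sub>j\<close>.

Locality says that \<open>(z\<^sub>i - z\<^sub>j)^N\<close> annihilates the effect of exchanging the neighbouring fields \<open>i\<close>
and \<open>j\<close>. Every order is reached from any other by such exchanges, so \<open>F = \<Prod>(z\<^sub>i - z\<^sub>j)^N C xs\<close> does not depend
on \<open>xs\<close> (\<open>correlator_common_numerator\<close>). Because degrees in the graded space are nonnegative, the last
field in \<open>xs\<close> has its exponent bounded below in \<open>C xs\<close>; any field may be put last, so all exponents in
\<open>F\<close> are bounded below. Because the functional sees finitely many degrees, the total exponent is bounded
above. Hence \<open>F\<close> is a Laurent polynomial (\<open>finite_numerator\<close>).

It remains to divide. If \<open>i\<close> stands before \<open>j\<close> in \<open>xs\<close>, then \<open>C xs\<close> vanishes far out in the direction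
\<open>e\<^sub>i - e\<^sub>j\<close>, since the fields after \<open>i\<close> lower the degree too much (\<open>correlator_vanishes_along\<close>). So
a relation \<open>(z\<^sub>i - z\<^sub>j) X = Y\<close> can be solved for \<open>X\<close> by a telescoping sum, which is
the geometric expansion of \<open>1/(z\<^sub>i - z\<^sub>j)\<close> for \<open>\<bar>z\<^sub>j\<bar> < \<bar>z\<^sub>i\<bar>\<close>, and
\<open>\<Sum>\<bar>X\<^sub>a z^a\<bar> \<le> \<Sum>\<bar>Y\<^sub>a z^a\<bar> / (\<bar>z\<^sub>i\<bar> - \<bar>z\<^sub>j\<bar>)\<close> (\<open>abs_convergent_divide_diff\<close>). Removing the factors of the product
one at a time bounds the series of absolute values by a continuous function on the domain
attached to \<open>xs\<close>, and shows that its sum is \<open>F(z) / \<Prod>(z\<^sub>i - z\<^sub>j)^N\<close>, the same function for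
every order.\<close>

section \<open>Multiplying a Laurent series by differences of variables\<close>

definition monomial :: "('m::finite \<Rightarrow> int) \<Rightarrow> complex ^ 'm \<Rightarrow> complex" where
  "monomial a z = (\<Prod>i\<in>UNIV. (z $ i) powi (a i))"

lemma monomial_upd:
  assumes "z $ i \<noteq> 0"
  shows "monomial (a(i := a i + d)) z = monomial a z * (z $ i) powi d"
proof -
  have "monomial (a(i := a i + d)) z
      = (z $ i) powi (a i + d) * (\<Prod>k\<in>UNIV - {i}. (z $ k) powi (a k))"
    unfolding monomial_def by (subst prod.remove[of _ i]) (auto intro!: prod.cong)
  also have "\<dots> = ((z $ i) powi (a i) * (\<Prod>k\<in>UNIV - {i}. (z $ k) powi (a k))) * (z $ i) powi d"
    using assms by (simp add: power_int_add)
  also have "(z $ i) powi (a i) * (\<Prod>k\<in>UNIV - {i}. (z $ k) powi (a k)) = monomial a z"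
    unfolding monomial_def by (subst prod.remove[of _ i]) auto
  finally show ?thesis .
qed

text \<open>A series is represented by its coefficient function; this is its product with \<open>z\<^sub>i - z\<^sub>j\<close>.\<close>

definition mult_diff :: "'m \<Rightarrow> 'm \<Rightarrow> (('m \<Rightarrow> int) \<Rightarrow> complex) \<Rightarrow> ('m \<Rightarrow> int) \<Rightarrow> complex" where
  "mult_diff i j X a = X (a(i := a i - 1)) - X (a(j := a j - 1))"

lemma mult_diff_commute: "mult_diff i j (mult_diff k l X) = mult_diff k l (mult_diff i j X)"
proof -
  have upd: "(a(p := a p - 1))(q := (a(p := a p - 1)) q - 1)
      = (a(q := a q - 1))(p := (a(q := a q - 1)) p - 1)" for a :: "_ \<Rightarrow> int" and p q
    by (rule ext) (simp add: fun_upd_def)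
  show ?thesis
    unfolding mult_diff_def by (intro ext) (simp only: upd[of _ i] upd[of _ j] algebra_simps)
qed

lemma mult_diff_swap: "mult_diff j i X = (\<lambda>a. - mult_diff i j X a)"
  by (simp add: fun_eq_iff mult_diff_def)

lemma has_sum_mult_diff:
  assumes nz: "z $ i \<noteq> 0" "z $ j \<noteq> 0"
    and X: "((\<lambda>a. X a * monomial a z) has_sum s) UNIV"
  shows "((\<lambda>a. mult_diff i j X a * monomial a z) has_sum (z $ i - z $ j) * s) UNIV"
proof -
  have shift: "((\<lambda>a. X (a(k := a k - 1)) * monomial a z) has_sum (z $ k) * s) UNIV"
    if k: "z $ k \<noteq> 0" for k
  proof -
    have bij: "bij_betw (\<lambda>a::_ \<Rightarrow> int. a(k := a k - 1)) UNIV UNIV"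
      by (rule bij_betwI[where g = "\<lambda>a. a(k := a k + 1)"]) auto
    have "((\<lambda>a. X (a(k := a k - 1)) * monomial (a(k := a k - 1)) z) has_sum s) UNIV"
      using has_sum_reindex_bij_betw[OF bij, of "\<lambda>a. X a * monomial a z"] X by simp
    from has_sum_cmult_right[OF this, of "z $ k"]
    have "((\<lambda>a. X (a(k := a k - 1)) * (z $ k * monomial (a(k := a k - 1)) z)) has_sum z $ k * s) UNIV"
      by (simp add: mult.left_commute)
    moreover have "z $ k * monomial (a(k := a k - 1)) z = monomial a z" for a
      using k monomial_upd[OF k, of a "-1"] by (simp add: power_int_minus)
    ultimately show ?thesis by simp
  qed
  from has_sum_add[OF shift[OF nz(1)] has_sum_uminusI[OF shift[OF nz(2)]]] show ?thesis
    by (simp add: mult_diff_def algebra_simps)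
qed

text \<open>Factors are listed with repetitions, so that a power is divided out like any other product:
one linear factor at a time.\<close>

definition mult_diffs :: "('m \<times> 'm) list \<Rightarrow> (('m \<Rightarrow> int) \<Rightarrow> complex) \<Rightarrow> ('m \<Rightarrow> int) \<Rightarrow> complex" where
  "mult_diffs qs = foldr (\<lambda>(i, j). mult_diff i j) qs"

lemma mult_diffs_simps [simp]:
  "mult_diffs [] X = X"
  "mult_diffs ((i, j) # qs) X = mult_diff i j (mult_diffs qs X)"
  "mult_diffs (ps @ qs) X = mult_diffs ps (mult_diffs qs X)"
  "mult_diffs (replicate n (i, j)) X = (mult_diff i j ^^ n) X"
  by (simp_all add: mult_diffs_def)

lemma mult_diff_mult_diffs:
  "mult_diff i j (mult_diffs qs X) = mult_diffs qs (mult_diff i j X)"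
  by (induction qs) (auto simp: mult_diff_commute[of i j])

lemma mult_diff_pow_mult_diffs:
  "(mult_diff i j ^^ n) (mult_diffs qs X) = mult_diffs qs ((mult_diff i j ^^ n) X)"
  by (induction n) (simp_all add: mult_diff_mult_diffs)

lemma mult_diffs_zero [simp]: "mult_diffs qs (\<lambda>a. 0) = (\<lambda>a. 0)"
  by (induction qs) (auto simp: mult_diff_def fun_eq_iff)

lemma mult_diffs_diff:
  "mult_diffs qs (\<lambda>a. X a - Y a) = (\<lambda>a. mult_diffs qs X a - mult_diffs qs Y a)"
  by (induction qs) (auto simp: mult_diff_def fun_eq_iff)

text \<open>For support conditions: they survive multiplication by each linear factor, and so hold for the
intermediate products that occur when the factors are divided out one at a time.\<close>

lemma mult_diffs_preserve:
  assumes "P X" "\<And>i j Y. P Y \<Longrightarrow> P (mult_diff i j Y)"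
  shows "P (mult_diffs qs X)"
  by (induction qs) (auto intro: assms)

lemma has_sum_mult_diffs:
  assumes "\<And>i. z $ i \<noteq> 0" "((\<lambda>a. X a * monomial a z) has_sum s) UNIV"
  shows "((\<lambda>a. mult_diffs qs X a * monomial a z) has_sum
           (\<Prod>(i, j)\<leftarrow>qs. z $ i - z $ j) * s) UNIV"
  by (induction qs) (use assms in \<open>auto simp: mult.assoc intro!: has_sum_mult_diff\<close>)

text \<open>All the multiplications commute, so the power of \<open>z\<^sub>i - z\<^sub>j\<close> can be applied to the difference of the two
series first.\<close>

lemma mult_diffs_replicate_eq:
  assumes "(mult_diff i j ^^ N) (\<lambda>a. X a - Y a) = (\<lambda>a. 0)" "(i, j) \<in> set ps"
  shows "mult_diffs (concat (map (replicate N) ps)) X = mult_diffs (concat (map (replicate N) ps)) Y"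
proof -
  obtain us vs where ps: "ps = us @ (i, j) # vs" using assms(2) by (metis split_list)
  have "mult_diffs (concat (map (replicate N) ps)) (\<lambda>a. X a - Y a) = (\<lambda>a. 0)"
    by (simp add: ps mult_diff_pow_mult_diffs assms(1))
  then show ?thesis by (simp add: mult_diffs_diff fun_eq_iff)
qed

section \<open>Dividing a series by differences of variables\<close>

text \<open>A series that vanishes far out in the direction \<open>e\<^sub>i - e\<^sub>j\<close> is determined by its product with \<open>z\<^sub>i - z\<^sub>j\<close>.
A bound that depends on the starting exponent \<open>a\<close> suffices, because each coefficient is recovered
separately.\<close>

definition vanishes_along :: "'m \<Rightarrow> 'm \<Rightarrow> (('m \<Rightarrow> int) \<Rightarrow> complex) \<Rightarrow> bool" where
  "vanishes_along i j X \<longleftrightarrow>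
     (\<forall>a. \<forall>\<^sub>F k in sequentially. X (a(i := a i + int k, j := a j - int k)) = 0)"

lemma vanishes_along_mult_diff:
  assumes "vanishes_along i j X" "i \<noteq> j"
  shows "vanishes_along i j (mult_diff k l X)"
  unfolding vanishes_along_def
proof
  fix a :: "'a \<Rightarrow> int"
  have comm: "(a(i := a i + int n, j := a j - int n))(p := (a(i := a i + int n, j := a j - int n)) p - 1)
     = (a(p := a p - 1))(i := (a(p := a p - 1)) i + int n, j := (a(p := a p - 1)) j - int n)" for n p
    using assms(2) by (auto simp: fun_eq_iff)
  have "\<forall>\<^sub>F n in sequentially. X ((a(i := a i + int n, j := a j - int n))(p := (a(i := a i + int n, j := a j - int n)) p - 1)) = 0" for p
    unfolding comm using assms(1) unfolding vanishes_along_def by blast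
  from this[of k] this[of l]
  show "\<forall>\<^sub>F n in sequentially. mult_diff k l X (a(i := a i + int n, j := a j - int n)) = 0"
    unfolding mult_diff_def by eventually_elim simp
qed

text \<open>With \<open>Y = (z\<^sub>i - z\<^sub>j) X\<close>, the relation \<open>X\<^sub>a = Y\<^bsub>a+e\<^sub>i\<^esub> + X\<^bsub>a+e\<^sub>i-e\<^sub>j\<^esub>\<close> can be iterated until the last term vanishes. The
\<open>k\<close>-th summand has weight \<open>(\<bar>z\<^sub>j\<bar>/\<bar>z\<^sub>i\<bar>)^k / \<bar>z\<^sub>i\<bar>\<close> relative to the absolute series of \<open>Y\<close>, and these weights form a
geometric series with sum \<open>1/(\<bar>z\<^sub>i\<bar> - \<bar>z\<^sub>j\<bar>)\<close>. Only finite partial sums are rearranged.\<close>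

lemma abs_convergent_divide_diff:
  fixes X :: "('m::finite \<Rightarrow> int) \<Rightarrow> complex"
  assumes ij: "i \<noteq> j" and van: "vanishes_along i j X"
    and nz: "z $ j \<noteq> 0" and less: "norm (z $ j) < norm (z $ i)"
    and Y: "(\<lambda>a. norm (mult_diff i j X a * monomial a z)) summable_on UNIV"
  shows "(\<lambda>a. norm (X a * monomial a z)) summable_on UNIV"
    and "(\<Sum>\<^sub>\<infinity>a. norm (X a * monomial a z))
       \<le> (\<Sum>\<^sub>\<infinity>a. norm (mult_diff i j X a * monomial a z)) / (norm (z $ i) - norm (z $ j))"
proof -
  define Y where "Y = mult_diff i j X"
  define ri rj where "ri = norm (z $ i)" and "rj = norm (z $ j)"
  define S where "S = (\<Sum>\<^sub>\<infinity>a. norm (Y a * monomial a z))"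
  define t where "t k a = a(i := a i + (int k + 1), j := a j - int k)" for k and a :: "'m \<Rightarrow> int"
  have r: "0 < rj" "rj < ri" using nz less by (auto simp: ri_def rj_def)
  have nzi: "z $ i \<noteq> 0" using less by auto
  have Ysum: "(\<lambda>a. norm (Y a * monomial a z)) summable_on UNIV"
    using assms(5) by (simp add: Y_def)
  have S0: "0 \<le> S" unfolding S_def by (rule infsum_nonneg) simp
  have telescope: "X a = (\<Sum>k<K. Y (t k a)) + X (a(i := a i + int K, j := a j - int K))" for a K
  proof (induction K)
    case (Suc K)
    have "Y (t K a) = X (a(i := a i + int K, j := a j - int K))
        - X (a(i := a i + int (Suc K), j := a j - int (Suc K)))"
      using ij unfolding Y_def mult_diff_def t_def
      by (auto intro!: arg_cong2[where f = minus] arg_cong[where f = X])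
    then show ?case
      by (simp only: sum.lessThan_Suc add.assoc diff_add_cancel) (rule Suc.IH)
  qed simp
  have mon_t: "norm (monomial (t k a) z) = norm (monomial a z) * ri * (ri / rj) ^ k" for k a
  proof -
    have "monomial (t k a) z = monomial a z * (z $ i) powi (int k + 1) * (z $ j) powi (- int k)"
      using monomial_upd[OF nzi, of a "int k + 1"]
        monomial_upd[OF nz, of "a(i := a i + (int k + 1))" "- int k"] ij
      by (simp add: t_def)
    then have "norm (monomial (t k a) z) = norm (monomial a z) * ri powi (int k + 1) * rj powi (- int k)"
      by (simp add: norm_mult norm_power_int ri_def rj_def)
    then show ?thesis using r
      by (simp add: power_int_minus power_int_add power_mult_distrib power_inverse divide_inverse mult_ac)
  qed
  have bound: "(\<Sum>a\<in>B. norm (X a * monomial a z)) \<le> S / (ri - rj)" if B: "finite B" for B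
  proof -
    \<comment> \<open>The number of telescoping steps is chosen uniformly for the finitely many exponents in \<open>B\<close>.\<close>
    have "\<forall>\<^sub>F K in sequentially. \<forall>a\<in>B. X (a(i := a i + int K, j := a j - int K)) = 0"
      using van B unfolding vanishes_along_def by (simp add: eventually_ball_finite)
    then obtain K where K: "\<And>a. a \<in> B \<Longrightarrow> X (a(i := a i + int K, j := a j - int K)) = 0"
      by (auto simp: eventually_sequentially)
    have tle: "norm (X a * monomial a z)
        \<le> (\<Sum>k<K. norm (Y (t k a) * monomial (t k a) z) * ((rj / ri) ^ k / ri))"
      if a: "a \<in> B" for a
    proof -
      have "norm (X a * monomial a z) = norm (\<Sum>k<K. Y (t k a)) * norm (monomial a z)"
        using telescope[of a K] K[OF a] by (simp add: norm_mult)
      also have "\<dots> \<le> (\<Sum>k<K. norm (Y (t k a))) * norm (monomial a z)"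
        by (intro mult_right_mono norm_sum) auto
      also have "\<dots> = (\<Sum>k<K. norm (Y (t k a) * monomial (t k a) z) * ((rj / ri) ^ k / ri))"
        unfolding sum_distrib_right norm_mult mon_t
        by (rule sum.cong) (use r in \<open>auto simp: field_simps\<close>)
      finally show ?thesis .
    qed
    have part: "(\<Sum>a\<in>B. norm (Y (t k a) * monomial (t k a) z)) \<le> S" for k
    proof -
      have inj: "inj_on (t k) B"
      proof (rule inj_on_inverseI)
        show "(\<lambda>b. b(i := b i - (int k + 1), j := b j + int k)) (t k a) = a" for a
          using ij by (auto simp: t_def)
      qed
      have "(\<Sum>a\<in>B. norm (Y (t k a) * monomial (t k a) z))
          = (\<Sum>a\<in>t k ` B. norm (Y a * monomial a z))"
        by (simp only: sum.reindex[OF inj] o_def)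
      also have "\<dots> \<le> S" unfolding S_def
        by (rule finite_sum_le_infsum) (use Ysum B in auto)
      finally show ?thesis .
    qed
    have "(\<Sum>a\<in>B. norm (X a * monomial a z))
        \<le> (\<Sum>a\<in>B. \<Sum>k<K. norm (Y (t k a) * monomial (t k a) z) * ((rj / ri) ^ k / ri))"
      by (rule sum_mono) (rule tle)
    also have "\<dots> = (\<Sum>k<K. (\<Sum>a\<in>B. norm (Y (t k a) * monomial (t k a) z)) * ((rj / ri) ^ k / ri))"
      by (subst sum.swap) (simp only: sum_distrib_right)
    also have "\<dots> \<le> (\<Sum>k<K. S * ((rj / ri) ^ k / ri))"
      by (intro sum_mono mult_right_mono part) (use r in auto)
    also have "\<dots> = S / ri * (\<Sum>k<K. (rj / ri) ^ k)"
      by (simp add: sum_distrib_left mult_ac)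
    also have "\<dots> \<le> S / ri * (1 / (1 - rj / ri))"
      using r S0 by (intro mult_left_mono) (auto simp: sum_gp_strict divide_right_mono)
    also have "\<dots> = S / (ri - rj)" using r by (simp add: field_simps)
    finally show ?thesis .
  qed
  show sumX: "(\<lambda>a. norm (X a * monomial a z)) summable_on UNIV"
    by (rule nonneg_bdd_above_summable_on) (auto intro!: bdd_aboveI2 bound)
  show "(\<Sum>\<^sub>\<infinity>a. norm (X a * monomial a z))
       \<le> (\<Sum>\<^sub>\<infinity>a. norm (mult_diff i j X a * monomial a z)) / (norm (z $ i) - norm (z $ j))"
    using infsum_le_finite_sums[OF sumX, of "S / (ri - rj)"] bound
    by (simp add: S_def Y_def ri_def rj_def)
qed

text \<open>The factors may be oriented either way: \<open>z\<^sub>i - z\<^sub>j\<close> and \<open>z\<^sub>j - z\<^sub>i\<close> give the same absolute values, and the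
one whose first variable is larger is divided out.\<close>

lemma abs_convergent_divide_diffs:
  fixes X :: "('m::finite \<Rightarrow> int) \<Rightarrow> complex"
  assumes nz: "\<And>i. z $ i \<noteq> 0"
    and sep: "\<And>i j. (i, j) \<in> set qs \<Longrightarrow> i \<noteq> j \<and> norm (z $ i) \<noteq> norm (z $ j)"
    and van: "\<And>i j. norm (z $ j) < norm (z $ i) \<Longrightarrow> vanishes_along i j X"
    and F: "(\<lambda>a. norm (mult_diffs qs X a * monomial a z)) summable_on UNIV"
  shows "(\<lambda>a. norm (X a * monomial a z)) summable_on UNIV \<and>
     (\<Sum>\<^sub>\<infinity>a. norm (X a * monomial a z))
       \<le> (\<Sum>\<^sub>\<infinity>a. norm (mult_diffs qs X a * monomial a z))
         / (\<Prod>(i, j)\<leftarrow>qs. \<bar>norm (z $ i) - norm (z $ j)\<bar>)"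
  using sep F
proof (induction qs)
  case (Cons q qs)
  obtain i j where q: "q = (i, j)" by (cases q)
  define W where "W = mult_diffs qs X"
  have ij: "i \<noteq> j" "norm (z $ i) \<noteq> norm (z $ j)" using Cons.prems(1) q by auto
  have vanW: "vanishes_along k l W" if "norm (z $ l) < norm (z $ k)" for k l
  proof -
    have "k \<noteq> l" using that by auto
    then show ?thesis unfolding W_def
      using mult_diffs_preserve[where P = "vanishes_along k l", OF van[OF that]]
      by (simp add: vanishes_along_mult_diff)
  qed
  have S: "(\<lambda>a. norm (mult_diff i j W a * monomial a z)) summable_on UNIV"
    using Cons.prems(2) by (simp add: q W_def)
  have step: "(\<lambda>a. norm (W a * monomial a z)) summable_on UNIV \<and>
     (\<Sum>\<^sub>\<infinity>a. norm (W a * monomial a z))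
       \<le> (\<Sum>\<^sub>\<infinity>a. norm (mult_diff i j W a * monomial a z)) / \<bar>norm (z $ i) - norm (z $ j)\<bar>"
  proof (cases "norm (z $ j) < norm (z $ i)")
    case True
    then show ?thesis
      using abs_convergent_divide_diff[OF ij(1) vanW[OF True] nz True S] by simp
  next
    case False
    then have less: "norm (z $ i) < norm (z $ j)" using ij by simp
    have eq: "norm (mult_diff j i W a * monomial a z) = norm (mult_diff i j W a * monomial a z)" for a
      by (simp add: mult_diff_swap[of j i] norm_mult)
    show ?thesis
      using abs_convergent_divide_diff[OF ij(1)[symmetric] vanW[OF less] nz less] S less
      unfolding eq by simp
  qed
  have IH: "(\<lambda>a. norm (X a * monomial a z)) summable_on UNIV \<and>
     (\<Sum>\<^sub>\<infinity>a. norm (X a * monomial a z)) \<le> (\<Sum>\<^sub>\<infinity>a. norm (W a * monomial a z))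
         / (\<Prod>(i, j)\<leftarrow>qs. \<bar>norm (z $ i) - norm (z $ j)\<bar>)"
    unfolding W_def by (rule Cons.IH) (use Cons.prems step in \<open>auto simp: W_def\<close>)
  have "(\<Sum>\<^sub>\<infinity>a. norm (W a * monomial a z)) / (\<Prod>(i, j)\<leftarrow>qs. \<bar>norm (z $ i) - norm (z $ j)\<bar>)
     \<le> (\<Sum>\<^sub>\<infinity>a. norm (mult_diff i j W a * monomial a z)) / \<bar>norm (z $ i) - norm (z $ j)\<bar>
         / (\<Prod>(i, j)\<leftarrow>qs. \<bar>norm (z $ i) - norm (z $ j)\<bar>)"
    using step by (intro divide_right_mono prod_list_nonneg) auto
  with IH show ?case by (auto simp: q W_def)
qed simp

section \<open>Series with finite support\<close>

lemma sum_fun_upd: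
  fixes a :: "'m \<Rightarrow> int"
  assumes "finite I" "k \<in> I"
  shows "sum (a(k := t)) I = sum a I - a k + t"
  using assms by (simp add: sum.remove[of I k])

text \<open>Lower bounds on all coordinates and an upper bound on their sum confine the support to a box.\<close>

lemma finite_support:
  fixes X :: "('m::finite \<Rightarrow> int) \<Rightarrow> complex"
  assumes low: "\<And>i. \<exists>c. \<forall>a. X a \<noteq> 0 \<longrightarrow> c \<le> a i"
    and high: "\<exists>c. \<forall>a. X a \<noteq> 0 \<longrightarrow> sum a UNIV \<le> c"
  shows "finite {a. X a \<noteq> 0}"
proof -
  obtain c where c: "\<And>i a. X a \<noteq> 0 \<Longrightarrow> c i \<le> a i" using low by metis
  obtain C where C: "\<And>a. X a \<noteq> 0 \<Longrightarrow> sum a UNIV \<le> C" using high by metis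
  have "a i \<le> C - sum c (UNIV - {i})" if "X a \<noteq> 0" for a i
  proof -
    have "sum c (UNIV - {i}) \<le> sum a (UNIV - {i})" by (intro sum_mono c that)
    then show ?thesis using C[OF that] by (simp add: sum.remove[of UNIV i a])
  qed
  then have "{a. X a \<noteq> 0} \<subseteq> (\<Pi>\<^sub>E i\<in>UNIV. {c i..C - sum c (UNIV - {i})})"
    using c by auto
  then show ?thesis by (rule finite_subset) (auto intro: finite_PiE)
qed

lemma mult_diffs_low:
  assumes "\<exists>c. \<forall>a. X a \<noteq> 0 \<longrightarrow> c \<le> a i"
  shows "\<exists>c. \<forall>a. mult_diffs qs X a \<noteq> 0 \<longrightarrow> c \<le> a i"
proof (rule mult_diffs_preserve[where P = "\<lambda>X. \<exists>c. \<forall>a. X a \<noteq> 0 \<longrightarrow> c \<le> a i"])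
  fix k l and Y :: "('a \<Rightarrow> int) \<Rightarrow> complex"
  assume "\<exists>c. \<forall>a. Y a \<noteq> 0 \<longrightarrow> c \<le> a i"
  then obtain c where c: "\<And>a. Y a \<noteq> 0 \<Longrightarrow> c \<le> a i" by blast
  have "c \<le> a i" if "mult_diff k l Y a \<noteq> 0" for a
  proof -
    from that have "Y (a(k := a k - 1)) \<noteq> 0 \<or> Y (a(l := a l - 1)) \<noteq> 0"
      by (auto simp: mult_diff_def)
    then show ?thesis using c[of "a(k := a k - 1)"] c[of "a(l := a l - 1)"]
      by (auto split: if_splits)
  qed
  then show "\<exists>c. \<forall>a. mult_diff k l Y a \<noteq> 0 \<longrightarrow> c \<le> a i" by blast
qed (rule assms)

lemma mult_diffs_high:
  fixes X :: "('m::finite \<Rightarrow> int) \<Rightarrow> complex"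
  assumes "\<exists>c. \<forall>a. X a \<noteq> 0 \<longrightarrow> sum a UNIV \<le> c"
  shows "\<exists>c. \<forall>a. mult_diffs qs X a \<noteq> 0 \<longrightarrow> sum a UNIV \<le> c"
proof (rule mult_diffs_preserve[where P = "\<lambda>X. \<exists>c. \<forall>a. X a \<noteq> 0 \<longrightarrow> sum a UNIV \<le> c"])
  fix k l and Y :: "('m \<Rightarrow> int) \<Rightarrow> complex"
  assume "\<exists>c. \<forall>a. Y a \<noteq> 0 \<longrightarrow> sum a UNIV \<le> c"
  then obtain c where c: "\<And>a. Y a \<noteq> 0 \<Longrightarrow> sum a UNIV \<le> c" by blast
  have "sum a UNIV \<le> c + 1" if "mult_diff k l Y a \<noteq> 0" for a
  proof -
    from that have "Y (a(k := a k - 1)) \<noteq> 0 \<or> Y (a(l := a l - 1)) \<noteq> 0"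
      by (auto simp: mult_diff_def)
    then show ?thesis using c[of "a(k := a k - 1)"] c[of "a(l := a l - 1)"]
      unfolding sum_fun_upd[OF finite UNIV_I] by linarith
  qed
  then show "\<exists>c. \<forall>a. mult_diff k l Y a \<noteq> 0 \<longrightarrow> sum a UNIV \<le> c" by blast
qed (rule assms)

lemma has_sum_laurent_polynomial:
  assumes "finite {a. F a \<noteq> 0}"
  shows "((\<lambda>a. F a * monomial a z) has_sum (\<Sum>a | F a \<noteq> 0. F a * monomial a z)) UNIV"
proof -
  have "((\<lambda>a. F a * monomial a z) has_sum (\<Sum>a | F a \<noteq> 0. F a * monomial a z)) {a. F a \<noteq> 0}"
    using assms by (rule has_sum_finite)
  then show ?thesis by (rule has_sum_cong_neutral[THEN iffD1, rotated -1]) auto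
qed

lemma infsum_finite_support:
  fixes X :: "'a \<Rightarrow> 'b::{t2_space, topological_comm_monoid_add}"
  assumes "finite S" "\<And>a. a \<notin> S \<Longrightarrow> X a = 0"
  shows "X summable_on UNIV" "infsum X UNIV = sum X S"
proof -
  have "(X has_sum sum X S) S" using assms(1) by (rule has_sum_finite)
  then have "(X has_sum sum X S) UNIV"
    by (rule has_sum_cong_neutral[THEN iffD1, rotated -1]) (use assms(2) in auto)
  then show "X summable_on UNIV" "infsum X UNIV = sum X S"
    by (auto simp: summable_on_def infsumI)
qed

section \<open>The sum of a series with a finitely supported multiple\<close>

lemma prod_list_concat_replicate:
  fixes h :: "'a \<Rightarrow> 'b::comm_monoid_mult"
  shows "distinct ps \<Longrightarrow> (\<Prod>q\<leftarrow>concat (map (replicate N) ps). h q) = (\<Prod>q\<in>set ps. h q ^ N)"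
  by (induction ps) (simp_all add: prod_list_replicate)

text \<open>The bound in the second claim is continuous in \<open>z\<close>, which yields local uniformity. The
third claim needs the first: only for a convergent series does multiplication by \<open>z\<^sub>i - z\<^sub>j\<close> multiply
the sum.\<close>

lemma convergence_from_numerator:
  fixes X :: "('m::{finite,linorder} \<Rightarrow> int) \<Rightarrow> complex" and z :: "complex ^ 'm::{finite,linorder}" and F :: "('m \<Rightarrow> int) \<Rightarrow> complex"
  assumes ps: "distinct ps" "set ps = {(i, j). i < j}"
    and F: "F = mult_diffs (concat (map (replicate N) ps)) X" and fin: "finite {a. F a \<noteq> 0}"
    and nz: "\<And>i. z $ i \<noteq> 0" and sep: "\<And>i j. i \<noteq> j \<Longrightarrow> norm (z $ i) \<noteq> norm (z $ j)"
    and van: "\<And>i j. norm (z $ j) < norm (z $ i) \<Longrightarrow> vanishes_along i j X"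
  shows "(\<lambda>a. norm (X a * monomial a z)) summable_on UNIV"
    and "(\<Sum>\<^sub>\<infinity>a. norm (X a * monomial a z))
       \<le> (\<Sum>a | F a \<noteq> 0. norm (F a * monomial a z))
         / (\<Prod>(i, j)\<in>{(i, j). i < j}. \<bar>norm (z $ i) - norm (z $ j)\<bar> ^ N)"
    and "((\<lambda>a. X a * monomial a z) has_sum
           (\<Sum>a | F a \<noteq> 0. F a * monomial a z) / (\<Prod>(i, j)\<in>{(i, j). i < j}. (z $ i - z $ j) ^ N)) UNIV"
proof -
  let ?qs = "concat (map (replicate N) ps)"
  have prod: "(\<Prod>(i, j)\<leftarrow>?qs. h i j) = (\<Prod>(i, j)\<in>{(i, j). i < j}. h i j ^ N)"
    for h :: "'m \<Rightarrow> 'm \<Rightarrow> 'b::comm_monoid_mult"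
    using prod_list_concat_replicate[OF ps(1), where N = N and h = "case_prod h"]
    by (simp add: ps(2) case_prod_unfold)
  have qs: "i \<noteq> j" if "(i, j) \<in> set ?qs" for i j
    using that ps(2) by (auto simp: in_set_replicate)
  note finF = infsum_finite_support[OF fin, of "\<lambda>a. norm (F a * monomial a z)"]
  have F_summable: "(\<lambda>a. norm (mult_diffs ?qs X a * monomial a z)) summable_on UNIV"
    using finF(1) by (simp flip: F)
  have sep': "i \<noteq> j \<and> norm (z $ i) \<noteq> norm (z $ j)" if "(i, j) \<in> set ?qs" for i j
    using qs[OF that] sep by blast
  note main = abs_convergent_divide_diffs[OF nz sep' van F_summable]
  show summable: "(\<lambda>a. norm (X a * monomial a z)) summable_on UNIV"
    using main by simp
  show "(\<Sum>\<^sub>\<infinity>a. norm (X a * monomial a z))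
       \<le> (\<Sum>a | F a \<noteq> 0. norm (F a * monomial a z))
         / (\<Prod>(i, j)\<in>{(i, j). i < j}. \<bar>norm (z $ i) - norm (z $ j)\<bar> ^ N)"
    using main finF(2) by (simp only: prod F[symmetric]) simp
  obtain s where s: "((\<lambda>a. X a * monomial a z) has_sum s) UNIV"
    using abs_summable_summable[OF summable] by (auto simp: summable_on_def)
  let ?D = "\<Prod>(i, j)\<in>{(i, j). i < j}. (z $ i - z $ j) ^ N"
  have "((\<lambda>a. F a * monomial a z) has_sum ?D * s) UNIV"
    using has_sum_mult_diffs[OF nz s, of ?qs] by (simp only: prod F)
  then have "(\<Sum>a | F a \<noteq> 0. F a * monomial a z) = ?D * s"
    using has_sum_laurent_polynomial[OF fin] has_sum_unique by blast
  moreover have "?D \<noteq> 0"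
  proof -
    have "z $ i \<noteq> z $ j" if "i < j" for i j using sep[OF less_imp_neq[OF that]] by auto
    then show ?thesis by (auto simp: prod_zero_iff)
  qed
  ultimately have "s = (\<Sum>a | F a \<noteq> 0. F a * monomial a z) / ?D"
    by (simp add: field_simps)
  with s show "((\<lambda>a. X a * monomial a z) has_sum
           (\<Sum>a | F a \<noteq> 0. F a * monomial a z) / ?D) UNIV" by simp
qed

section \<open>Swapping neighbouring fields\<close>

text \<open>Indexed by exponents rather than mode numbers: the mode \<open>- a k - 1\<close> is the coefficient of the \<open>a k\<close>-th
power of the variable of the field \<open>k\<close>.\<close>

definition mode_product :: "('m \<Rightarrow> int \<Rightarrow> 'v \<Rightarrow> 'v) \<Rightarrow> 'm list \<Rightarrow> ('m \<Rightarrow> int) \<Rightarrow> 'v \<Rightarrow> 'v" where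
  "mode_product A xs a = foldr (\<lambda>k. A k (- a k - 1)) xs"

lemma mode_product_simps [simp]:
  "mode_product A [] a v = v"
  "mode_product A (k # xs) a v = A k (- a k - 1) (mode_product A xs a v)"
  "mode_product A (xs @ ys) a v = mode_product A xs a (mode_product A ys a v)"
  by (simp_all add: mode_product_def)

lemma mode_product_upd [simp]:
  "k \<notin> set xs \<Longrightarrow> mode_product A xs (a(k := t)) v = mode_product A xs a v"
  by (induction xs) auto

text \<open>Bubble sort. An element is moved to the front by swaps with its left neighbours, and the
remaining lists are compared by induction; the prefix \<open>ps\<close> carries the elements that are
already in place.\<close>

lemma adjacent_swap_invariant:
  assumes swap: "\<And>us x y vs. distinct (us @ x # y # vs) \<Longrightarrow> g (us @ x # y # vs) = g (us @ y # x # vs)"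
    and "distinct xs" "distinct ys" "set xs = set ys"
  shows "g xs = g ys"
proof -
  have bubble: "g (ps @ us @ x # vs) = g (ps @ x # us @ vs)" if "distinct (ps @ us @ x # vs)" for ps us x vs
    using that
  proof (induction us arbitrary: vs rule: rev_induct)
    case (snoc u us)
    have "g ((ps @ us) @ u # x # vs) = g ((ps @ us) @ x # u # vs)"
      by (rule swap) (use snoc.prems in auto)
    moreover have "g (ps @ us @ x # u # vs) = g (ps @ x # us @ u # vs)"
      by (rule snoc.IH) (use snoc.prems in auto)
    ultimately show ?case by simp
  qed simp
  have "g (ps @ xs) = g (ps @ ys)" if "distinct (ps @ xs)" "distinct (ps @ ys)" "set xs = set ys" for ps
    using that
  proof (induction xs arbitrary: ps ys)
    case (Cons x xs)
    have "x \<in> set ys" using Cons.prems(3) by (metis list.set_intros(1))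
    then obtain us vs where ys: "ys = us @ x # vs" by (metis split_list)
    have "g ((ps @ [x]) @ xs) = g ((ps @ [x]) @ (us @ vs))"
      by (rule Cons.IH) (use Cons.prems ys in auto)
    with bubble[of ps us x vs] Cons.prems(2) show ?case by (simp add: ys)
  qed simp
  from this[of "[]"] show ?thesis using assms by simp
qed

text \<open>Transfers a power of \<open>z\<^sub>1 - z\<^sub>2\<close> acting on an operator-valued series in two variables to the scalar series
in all variables. The functional \<open>\<phi>\<close> and the vector \<open>w\<close> stand for the fields to the left and to the right of
the pair; they depend on the other exponents only, and so are constant under the shifts.\<close>

lemma mult_diff_pow_eval:
  fixes C :: "int \<Rightarrow> int \<Rightarrow> 'v \<Rightarrow> 'v::ab_group_add"
  assumes ij: "i \<noteq> j"
    and diff: "\<And>a x y. \<phi> a (x - y) = \<phi> a x - \<phi> a y"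
    and \<phi>: "\<And>a t x. \<phi> (a(i := t)) x = \<phi> a x" "\<And>a t x. \<phi> (a(j := t)) x = \<phi> a x"
    and w: "\<And>a t. w (a(i := t)) = w a" "\<And>a t. w (a(j := t)) = w a"
  shows "(mult_diff i j ^^ n) (\<lambda>a. \<phi> a (C (a i) (a j) (w a))) a
       = \<phi> a ((mult_z1_minus_z2 ^^ n) C (a i) (a j) (w a))"
proof (induction n arbitrary: a)
  case (Suc n)
  let ?D = "(mult_z1_minus_z2 ^^ n) C"
  have "(mult_diff i j ^^ Suc n) (\<lambda>a. \<phi> a (C (a i) (a j) (w a))) a
      = \<phi> a (?D (a i - 1) (a j) (w a)) - \<phi> a (?D (a i) (a j - 1) (w a))"
    by (simp only: funpow.simps o_apply mult_diff_def Suc.IH \<phi> w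
        fun_upd_same fun_upd_other[OF ij] fun_upd_other[OF ij[symmetric]])
  also have "\<dots> = \<phi> a ((mult_z1_minus_z2 ^^ Suc n) C (a i) (a j) (w a))"
    by (simp only: funpow.simps o_apply mult_z1_minus_z2_def diff)
  finally show ?case .
qed simp

lemma mult_z1_minus_z2_pow_mono:
  assumes "(mult_z1_minus_z2 ^^ m) C = (\<lambda>a b v. 0)" "m \<le> n"
  shows "(mult_z1_minus_z2 ^^ n) C = (\<lambda>a b v. 0)"
proof -
  have "mult_z1_minus_z2 (\<lambda>a b v. 0 :: 'a) = (\<lambda>a b v. 0)"
    by (intro ext) (simp add: mult_z1_minus_z2_def)
  then have "(mult_z1_minus_z2 ^^ (k + m)) C = (\<lambda>a b v. 0)" for k
    by (induction k) (simp_all add: assms(1))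
  then show ?thesis using assms(2) by (metis le_add_diff_inverse2)
qed

lemma locality_kills_swap:
  assumes loc: "(mult_z1_minus_z2 ^^ N) (commutator_series (A i) (A j)) = (\<lambda>a b v. 0)"
    and add: "\<And>k n x y. A k n (x - y) = A k n x - A k n y" "\<And>x y. v' (x - y) = v' x - v' y"
    and zero: "v' 0 = 0" "\<And>k n. A k n 0 = 0"
    and dist: "distinct (us @ i # j # vs)"
  shows "(mult_diff i j ^^ N) (\<lambda>a. v' (mode_product A (us @ i # j # vs) a v)
           - v' (mode_product A (us @ j # i # vs) a v)) = (\<lambda>a. 0)"
proof
  fix a
  define \<phi> where "\<phi> a x = v' (mode_product A us a x)" for a x
  have linear: "mode_product A us a (x - y) = mode_product A us a x - mode_product A us a y"
    "mode_product A us a 0 = 0" for a x y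
    by (induction us) (simp_all add: add zero)
  have eq: "(\<lambda>a. v' (mode_product A (us @ i # j # vs) a v) - v' (mode_product A (us @ j # i # vs) a v))
      = (\<lambda>a. \<phi> a (commutator_series (A i) (A j) (a i) (a j) (mode_product A vs a v)))"
    by (simp add: \<phi>_def commutator_series_def linear add)
  have "(mult_diff i j ^^ N) (\<lambda>a. \<phi> a (commutator_series (A i) (A j) (a i) (a j) (mode_product A vs a v))) a
      = \<phi> a ((mult_z1_minus_z2 ^^ N) (commutator_series (A i) (A j)) (a i) (a j) (mode_product A vs a v))"
  proof (rule mult_diff_pow_eval)
    have "i \<notin> set us" "j \<notin> set us" "i \<notin> set vs" "j \<notin> set vs" using dist by auto
    note upd = this[THEN mode_product_upd]
    show "i \<noteq> j" using dist by simp
    show "\<phi> b (x - y) = \<phi> b x - \<phi> b y" for b x y by (simp only: \<phi>_def linear add)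
    show "\<phi> (b(i := t)) x = \<phi> b x" "\<phi> (b(j := t)) x = \<phi> b x" for b t x
      by (simp_all only: \<phi>_def upd)
    show "mode_product A vs (b(i := t)) v = mode_product A vs b v"
      "mode_product A vs (b(j := t)) v = mode_product A vs b v" for b t
      by (simp_all only: upd)
  qed
  also have "\<dots> = 0" by (simp add: loc \<phi>_def linear zero)
  finally show "(mult_diff i j ^^ N) (\<lambda>a. v' (mode_product A (us @ i # j # vs) a v)
           - v' (mode_product A (us @ j # i # vs) a v)) a = 0" unfolding eq .
qed

section \<open>Degree bounds for correlators\<close>

context graded_vector_space
begin

text \<open>The degrees are taken as integers, so that the set of degrees can be shifted by a possibly
negative weight; negative members contribute nothing. This is how the nonnegativity of the
grading enters.\<close>

definition degrees_in :: "int set \<Rightarrow> 'v set" where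
  "degrees_in D = span (\<Union>n\<in>{n. int n \<in> D}. V n)"

lemma decompose:
  obtains c where "\<And>n. c n \<in> V n" "finite {n. c n \<noteq> 0}" "v = (\<Sum>n | c n \<noteq> 0. c n)"
  using direct_sum[of v] by blast

lemma mem_degrees_in: "x \<in> V n \<Longrightarrow> int n \<in> D \<Longrightarrow> x \<in> degrees_in D"
  unfolding degrees_in_def by (auto intro: span_base)

lemma degrees_in_empty: "(\<And>n. int n \<notin> D) \<Longrightarrow> degrees_in D = {0}"
  by (simp add: degrees_in_def)

text \<open>In the decomposition \<open>w = \<Sum>c n\<close>, the vectors \<open>(n - m) c n\<close> are a decomposition of \<open>L0 w - m w = 0\<close>. By
uniqueness they all vanish, which leaves the component of degree \<open>m\<close>. For negative \<open>m\<close> nothing is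
left, and \<open>w = 0\<close>.\<close>

lemma eigenvector_homogeneous:
  assumes "L0 w = smul (of_int m) w"
  shows "w \<in> degrees_in {m}"
proof -
  interpret L0: module_hom smul smul L0
    using linear_L0 by (simp add: Vector_Spaces.linear_def)
  obtain c where c: "\<And>n. c n \<in> V n" "finite {n. c n \<noteq> 0}" "w = (\<Sum>n | c n \<noteq> 0. c n)"
    by (rule decompose[of w]) blast
  define d where "d n = smul (of_nat n - of_int m) (c n)" for n
  have sub: "{n. d n \<noteq> 0} \<subseteq> {n. c n \<noteq> 0}" by (auto simp: d_def)
  have "(\<Sum>n | d n \<noteq> 0. d n) = (\<Sum>n | c n \<noteq> 0. d n)"
    by (rule sum.mono_neutral_left) (use c(2) sub in auto)
  also have "\<dots> = (\<Sum>n | c n \<noteq> 0. L0 (c n) - smul (of_int m) (c n))"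
    by (simp only: d_def scale_left_diff_distrib L0_eigen[OF c(1)])
  also have "\<dots> = L0 w - smul (of_int m) w"
    by (simp only: sum_subtractf L0.sum[symmetric] scale_sum_right[symmetric] c(3)[symmetric])
  also have "\<dots> = 0" using assms by simp
  finally have d0: "(\<Sum>n | d n \<noteq> 0. d n) = 0" .
  define P where "P e \<longleftrightarrow> (\<forall>n. e n \<in> V n) \<and> finite {n. e n \<noteq> 0} \<and> 0 = (\<Sum>n | e n \<noteq> 0. e n)" for e
  have "\<exists>!e. P e" unfolding P_def by (rule direct_sum)
  moreover have "P d"
  proof -
    have "\<forall>n. d n \<in> V n" using subspace_scale[OF subspace_V c(1)] by (simp add: d_def)
    moreover have "finite {n. d n \<noteq> 0}" using c(2) sub by (rule rev_finite_subset)
    ultimately show ?thesis using d0 by (simp add: P_def)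
  qed
  moreover have "P (\<lambda>n. 0)" using subspace_0[OF subspace_V] by (simp add: P_def)
  ultimately have "d = (\<lambda>n. 0)" by blast
  then have "c n = 0" if "int n \<noteq> m" for n
  proof -
    have "(of_nat n :: complex) \<noteq> of_int m" using that by (metis of_int_eq_iff of_int_of_nat_eq)
    moreover have "d n = 0" by (simp add: \<open>d = (\<lambda>n. 0)\<close>)
    ultimately show ?thesis by (simp add: d_def)
  qed
  then have "c n \<in> degrees_in {m}" if "c n \<noteq> 0" for n
    using that c(1) by (intro mem_degrees_in[of _ n]) auto
  then show ?thesis unfolding c(3) degrees_in_def by (intro span_sum) simp
qed

text \<open>By the commutator with \<open>L0\<close>, a mode sends an eigenvector to an eigenvector with shifted eigenvalue.\<close>

lemma field_shifts_degrees:
  assumes lin: "Vector_Spaces.linear smul smul (A n)"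
    and comm: "\<And>v. L0 (A n v) - A n (L0 v) = smul (of_int (\<Delta> - n - 1)) (A n v)"
    and w: "w \<in> degrees_in D"
  shows "A n w \<in> degrees_in ((+) (\<Delta> - n - 1) ` D)"
proof -
  interpret A: module_hom smul smul "A n"
    using lin by (simp add: Vector_Spaces.linear_def)
  have hom: "A n x \<in> degrees_in ((+) (\<Delta> - n - 1) ` D)" if x: "x \<in> V k" and k: "int k \<in> D" for x k
  proof -
    have "L0 (A n x) = smul (of_int (\<Delta> - n - 1)) (A n x) + A n (L0 x)"
      using comm[of x] by (metis diff_add_cancel)
    also have "\<dots> = smul (of_int (\<Delta> - n - 1 + int k)) (A n x)"
      by (simp add: L0_eigen[OF x] A.scale flip: scale_left_distrib)
    finally have "A n x \<in> degrees_in {\<Delta> - n - 1 + int k}" by (rule eigenvector_homogeneous)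
    moreover have "degrees_in {\<Delta> - n - 1 + int k} \<subseteq> degrees_in ((+) (\<Delta> - n - 1) ` D)"
      unfolding degrees_in_def by (rule span_mono) (use k in auto)
    ultimately show ?thesis by blast
  qed
  have "A n ` degrees_in D = span (A n ` (\<Union>n\<in>{n. int n \<in> D}. V n))"
    unfolding degrees_in_def by (rule A.span_image[symmetric])
  also have "\<dots> \<subseteq> degrees_in ((+) (\<Delta> - n - 1) ` D)"
    by (rule span_minimal) (use hom in \<open>auto simp: degrees_in_def\<close>)
  finally show ?thesis using w by blast
qed

lemma mode_product_shifts_degrees:
  assumes "\<And>i n. Vector_Spaces.linear smul smul (A i n)"
    and "\<And>i n v. L0 (A i n v) - A i n (L0 v) = smul (of_int (\<Delta> i - n - 1)) (A i n v)"
    and "v \<in> degrees_in D"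
  shows "mode_product A xs a v \<in> degrees_in ((+) (\<Sum>k\<leftarrow>xs. \<Delta> k + a k) ` D)"
proof (induction xs)
  case Nil
  have "(+) (0::int) = id" by (rule ext) simp
  then show ?case using assms(3) by (simp only: mode_product_simps list.map sum_list.Nil id_apply image_ident)
next
  case (Cons k xs)
  have "A k (- a k - 1) (mode_product A xs a v) \<in> degrees_in ((+) (\<Delta> k - (- a k - 1) - 1) ` (+) (\<Sum>k\<leftarrow>xs. \<Delta> k + a k) ` D)"
    using field_shifts_degrees[where A = "A k" and n = "- a k - 1" and \<Delta> = "\<Delta> k",
        OF assms(1)[of k "- a k - 1"] assms(2)[of k "- a k - 1"] Cons.IH] .
  also have "(+) (\<Delta> k - (- a k - 1) - 1) ` (+) (\<Sum>k\<leftarrow>xs. \<Delta> k + a k) ` D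
      = (+) (\<Sum>k\<leftarrow>k # xs. \<Delta> k + a k) ` D"
    unfolding image_image by (rule image_cong) simp_all
  finally show ?case by (simp only: mode_product_simps)
qed

lemma bounded_degree: obtains K :: int where "v \<in> degrees_in {..K}"
proof -
  obtain c where c: "\<And>n. c n \<in> V n" "finite {n. c n \<noteq> 0}" "v = (\<Sum>n | c n \<noteq> 0. c n)"
    by (rule decompose[of v]) blast
  then have "c n \<in> degrees_in {..int (Max {n. c n \<noteq> 0})}" if "c n \<noteq> 0" for n
    using that by (intro mem_degrees_in[of _ n]) auto
  then have "v \<in> degrees_in {..int (Max {n. c n \<noteq> 0})}"
    unfolding c(3) degrees_in_def by (intro span_sum) simp
  then show ?thesis by (rule that)
qed

lemma nonneg_degree: "v \<in> degrees_in {0..}"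
proof -
  obtain c where c: "\<And>n. c n \<in> V n" "finite {n. c n \<noteq> 0}" "v = (\<Sum>n | c n \<noteq> 0. c n)"
    by (rule decompose[of v]) blast
  have "c n \<in> degrees_in {0..}" for n
    using c(1) by (intro mem_degrees_in[of _ n]) auto
  then show ?thesis unfolding c(3) degrees_in_def by (intro span_sum) simp
qed

lemma graded_dual_bounded:
  assumes "v' \<in> graded_dual smul V"
  obtains K :: int where "\<And>D x. D \<subseteq> {K<..} \<Longrightarrow> x \<in> degrees_in D \<Longrightarrow> v' x = 0"
proof -
  have lin: "Vector_Spaces.linear smul (*) v'" and fin: "finite {n. \<exists>x\<in>V n. v' x \<noteq> 0}"
    using assms by (auto simp: graded_dual_def)
  interpret v': module_hom smul "(*)" v' using lin by (simp add: Vector_Spaces.linear_def)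
  obtain K where K: "\<And>n x. x \<in> V n \<Longrightarrow> v' x \<noteq> 0 \<Longrightarrow> n \<le> K"
    using Max_ge[OF fin] by blast
  have "v' x = 0" if "D \<subseteq> {int K<..}" "x \<in> degrees_in D" for D x
  proof -
    have "v' x = 0" if "x \<in> V n" "int n \<in> D" for x n
      using K[OF that(1)] \<open>D \<subseteq> {int K<..}\<close> that(2) by fastforce
    then have "degrees_in D \<subseteq> {x. v' x = 0}" unfolding degrees_in_def
      by (intro span_minimal v'.subspace_kernel) auto
    then show ?thesis using that(2) by blast
  qed
  then show ?thesis using that by blast
qed

context
  fixes A :: "'m \<Rightarrow> int \<Rightarrow> 'v \<Rightarrow> 'v" and \<Delta> :: "'m \<Rightarrow> int" and v :: 'v and v' :: "'v \<Rightarrow> complex"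
  assumes linear_A: "\<And>i n. Vector_Spaces.linear smul smul (A i n)"
    and weight: "\<And>i n v. L0 (A i n v) - A i n (L0 v) = smul (of_int (\<Delta> i - n - 1)) (A i n v)"
    and dual: "v' \<in> graded_dual smul V"
begin

text \<open>If the exponents of the fields in \<open>ws\<close> are too negative, the fields in \<open>ws\<close> already send \<open>v\<close> to
negative degrees, hence to zero.\<close>

lemma correlator_suffix_bound:
  "\<exists>c. \<forall>us a. v' (mode_product A (us @ ws) a v) \<noteq> 0 \<longrightarrow> c \<le> sum_list (map a ws)"
proof -
  obtain K where K: "v \<in> degrees_in {..K}" by (rule bounded_degree)
  have "- K - sum_list (map \<Delta> ws) \<le> sum_list (map a ws)"
    if nz: "v' (mode_product A (us @ ws) a v) \<noteq> 0" for us a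
  proof (rule ccontr)
    assume "\<not> ?thesis"
    then have "(\<Sum>k\<leftarrow>ws. \<Delta> k + a k) + K < 0" by (simp add: sum_list_addf)
    then have "degrees_in ((+) (\<Sum>k\<leftarrow>ws. \<Delta> k + a k) ` {..K}) = {0}"
      by (intro degrees_in_empty) auto
    then have zero: "mode_product A ws a v = 0"
      using mode_product_shifts_degrees[of A \<Delta>, OF linear_A weight K, of ws a] by simp
    have "A k n 0 = 0" for k n
      using linear_A[of k n] by (intro module_hom.zero[of smul smul]) (simp add: Vector_Spaces.linear_def)
    then have "mode_product A us a 0 = 0" by (induction us) simp_all
    moreover have "v' 0 = 0"
      using dual by (intro module_hom.zero[of smul "(*)"]) (simp add: graded_dual_def Vector_Spaces.linear_def)
    ultimately show False using nz by (simp add: zero)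
  qed
  then show ?thesis by blast
qed

text \<open>A large total exponent raises all degrees beyond those on which the functional is nonzero; here the
starting degrees are bounded below by zero.\<close>

lemma correlator_total_bound:
  "\<exists>c. \<forall>a. v' (mode_product A xs a v) \<noteq> 0 \<longrightarrow> sum_list (map a xs) \<le> c"
proof -
  obtain K where K: "\<And>D x. D \<subseteq> {K<..} \<Longrightarrow> x \<in> degrees_in D \<Longrightarrow> v' x = 0"
    using graded_dual_bounded[OF dual] by blast
  have "sum_list (map a xs) \<le> K - sum_list (map \<Delta> xs)"
    if nz: "v' (mode_product A xs a v) \<noteq> 0" for a
  proof (rule ccontr)
    assume "\<not> ?thesis"
    then have "(+) (\<Sum>k\<leftarrow>xs. \<Delta> k + a k) ` {0..} \<subseteq> {K<..}" by (auto simp: sum_list_addf)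
    from K[OF this mode_product_shifts_degrees[of A \<Delta>, OF linear_A weight nonneg_degree]]
    show False using nz by blast
  qed
  then show ?thesis by blast
qed

text \<open>Moving in the direction \<open>e\<^sub>i - e\<^sub>j\<close> leaves every exponent after \<open>i\<close> unchanged except that of \<open>j\<close>, so the sum
over \<open>ws\<close> decreases without bound.\<close>

lemma correlator_vanishes_along:
  assumes dist: "distinct (us @ i # ws)" and j: "j \<in> set ws"
  shows "vanishes_along i j (\<lambda>a. v' (mode_product A (us @ i # ws) a v))"
  unfolding vanishes_along_def
proof
  fix a :: "'m \<Rightarrow> int"
  obtain c where c: "\<And>us a. v' (mode_product A (us @ ws) a v) \<noteq> 0 \<Longrightarrow> c \<le> sum_list (map a ws)"
    using correlator_suffix_bound by blast
  have "v' (mode_product A (us @ i # ws) (a(i := a i + int n, j := a j - int n)) v) = 0"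
    if n: "nat (sum a (set ws) - c) < n" for n
  proof (rule ccontr)
    let ?a = "a(i := a i + int n, j := a j - int n)"
    assume "\<not> ?thesis"
    then have "c \<le> sum_list (map ?a ws)" using c[of "us @ [i]" ?a] by simp
    also have "\<dots> = sum ?a (set ws)" using dist by (simp only: sum_list_distinct_conv_sum_set distinct_append distinct.simps)
    also have "\<dots> = sum (a(j := a j - int n)) (set ws)"
      by (rule sum.cong) (use dist in auto)
    also have "\<dots> = sum a (set ws) - int n" using j by (simp only: sum_fun_upd[OF finite_set j])
    finally show False using n by linarith
  qed
  then show "\<forall>\<^sub>F n in sequentially. v' (mode_product A (us @ i # ws) (a(i := a i + int n, j := a j - int n)) v) = 0"
    unfolding eventually_sequentially by (intro exI[of _ "Suc (nat (sum a (set ws) - c))"]) (metis Suc_le_lessD)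
qed

end

section \<open>The common numerator of the correlators\<close>

text \<open>Each neighbouring pair is swapped at the cost of one of the factors \<open>(z\<^sub>i - z\<^sub>j)^N\<close>. The factors are
indexed by pairs with \<open>i < j\<close>; a swap of a descending pair is the reverse of a swap of an ascending
one.\<close>

lemma correlator_common_numerator:
  fixes A :: "'m::{finite,linorder} \<Rightarrow> int \<Rightarrow> 'v \<Rightarrow> 'v"
  assumes linear_A: "\<And>i n. Vector_Spaces.linear smul smul (A i n)"
    and loc: "\<And>i j. i \<noteq> j \<Longrightarrow> (mult_z1_minus_z2 ^^ N) (commutator_series (A i) (A j)) = (\<lambda>a b v. 0)"
    and dual: "v' \<in> graded_dual smul V"
    and ps: "set ps = {(i, j). i < j}"
    and xs: "distinct xs" "set xs = UNIV" and ys: "distinct ys" "set ys = UNIV"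
  shows "mult_diffs (concat (map (replicate N) ps)) (\<lambda>a. v' (mode_product A xs a v))
       = mult_diffs (concat (map (replicate N) ps)) (\<lambda>a. v' (mode_product A ys a v))"
proof (rule adjacent_swap_invariant[where g = "\<lambda>xs. mult_diffs (concat (map (replicate N) ps)) (\<lambda>a. v' (mode_product A xs a v))"])
  have hom: "module_hom smul smul (A k n)" for k n
    using linear_A by (simp add: Vector_Spaces.linear_def)
  have hom': "module_hom smul (*) v'"
    using dual by (simp add: graded_dual_def Vector_Spaces.linear_def)
  have kill: "(mult_diff i j ^^ N) (\<lambda>a. v' (mode_product A (us @ i # j # vs) a v)
           - v' (mode_product A (us @ j # i # vs) a v)) = (\<lambda>a. 0)"
    if d: "distinct (us @ i # j # vs)" for us i j vs
  proof (rule locality_kills_swap)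
    show "(mult_z1_minus_z2 ^^ N) (commutator_series (A i) (A j)) = (\<lambda>a b v. 0)"
      by (rule loc) (use d in simp)
    show "A k n (x - y) = A k n x - A k n y" for k n x y by (rule module_hom.diff[OF hom])
    show "v' (x - y) = v' x - v' y" for x y by (rule module_hom.diff[OF hom'])
    show "v' 0 = 0" by (rule module_hom.zero[OF hom'])
    show "A k n 0 = 0" for k n by (rule module_hom.zero[OF hom])
    show "distinct (us @ i # j # vs)" by (rule d)
  qed
  fix us vs :: "'m list" and x y
  assume d: "distinct (us @ x # y # vs)"
  then have d': "distinct (us @ y # x # vs)" by auto
  show "mult_diffs (concat (map (replicate N) ps)) (\<lambda>a. v' (mode_product A (us @ x # y # vs) a v))
      = mult_diffs (concat (map (replicate N) ps)) (\<lambda>a. v' (mode_product A (us @ y # x # vs) a v))"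
  proof (cases "x < y")
    case True
    then have "(x, y) \<in> set ps" using ps by simp
    then show ?thesis by (rule mult_diffs_replicate_eq[OF kill[OF d]])
  next
    case False
    then have "y < x" using d by auto
    then have "(y, x) \<in> set ps" using ps by simp
    from mult_diffs_replicate_eq[OF kill[OF d'] this] show ?thesis by (rule sym)
  qed
qed (use xs ys in simp_all)

text \<open>The lower bound on the exponent of \<open>i\<close> is read off from the order in which \<open>i\<close> comes last, which is allowed
because the numerator is the same for all orders.\<close>

lemma finite_numerator:
  fixes A :: "'m::{finite,linorder} \<Rightarrow> int \<Rightarrow> 'v \<Rightarrow> 'v" and \<Delta> :: "'m \<Rightarrow> int"
  assumes linear_A: "\<And>i n. Vector_Spaces.linear smul smul (A i n)"
    and weight: "\<And>i n v. L0 (A i n v) - A i n (L0 v) = smul (of_int (\<Delta> i - n - 1)) (A i n v)"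
    and loc: "\<And>i j. i \<noteq> j \<Longrightarrow> (mult_z1_minus_z2 ^^ N) (commutator_series (A i) (A j)) = (\<lambda>a b v. 0)"
    and dual: "v' \<in> graded_dual smul V"
    and ps: "set ps = {(i, j). i < j}"
    and xs: "distinct xs" "set xs = UNIV"
  shows "finite {a. mult_diffs (concat (map (replicate N) ps)) (\<lambda>a. v' (mode_product A xs a v)) a \<noteq> 0}"
proof (rule finite_support)
  let ?F = "\<lambda>xs. mult_diffs (concat (map (replicate N) ps)) (\<lambda>a. v' (mode_product A xs a v))"
  fix i
  let ?ys = "remove1 i xs @ [i]"
  have ys: "distinct ?ys" "set ?ys = UNIV" using xs by (auto simp: set_remove1_eq)
  have eq: "?F xs = ?F ?ys"
    by (rule correlator_common_numerator[OF linear_A loc dual ps xs ys])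
  obtain c where c: "\<And>us a. v' (mode_product A (us @ [i]) a v) \<noteq> 0 \<Longrightarrow> c \<le> sum_list (map a [i])"
    using correlator_suffix_bound[where A = A and ws = "[i]" and v = v, OF linear_A weight dual] by blast
  have low: "\<exists>c. \<forall>a. v' (mode_product A ?ys a v) \<noteq> 0 \<longrightarrow> c \<le> a i"
    using c[of "remove1 i xs"] by (intro exI[of _ c]) simp
  show "\<exists>c. \<forall>a. ?F xs a \<noteq> 0 \<longrightarrow> c \<le> a i"
    unfolding eq by (rule mult_diffs_low) (rule low)
next
  have "sum_list (map a xs) = sum a UNIV" for a :: "'m \<Rightarrow> int"
    using xs by (simp add: sum_list_distinct_conv_sum_set)
  then show "\<exists>c. \<forall>a. mult_diffs (concat (map (replicate N) ps)) (\<lambda>a. v' (mode_product A xs a v)) a \<noteq> 0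
      \<longrightarrow> sum a UNIV \<le> c"
    using correlator_total_bound[where A = A and xs = xs and v = v, OF linear_A weight dual]
    by (intro mult_diffs_high) simp
qed

end

section \<open>Holomorphic functions of several variables\<close>

lemma holomorphic_several_const: "holomorphic_several_on (\<lambda>z. c) S"
  unfolding holomorphic_several_on_def by (auto intro!: exI[of _ "\<lambda>_. 0"])

lemma holomorphic_several_coordinate: "holomorphic_several_on (\<lambda>z. z $ i) S"
  unfolding holomorphic_several_on_def
  by (auto intro!: exI[of _ "\<lambda>z. z $ i"] bounded_linear_imp_has_derivative bounded_linear_vec_nth)

lemma holomorphic_severalE:
  assumes "holomorphic_several_on f S" "z \<in> S"
  obtains D where "(f has_derivative D) (at z within S)" "\<And>c w. D (c *s w) = c * D w"
  using assms unfolding holomorphic_several_on_def by blast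

lemma holomorphic_several_add:
  assumes "holomorphic_several_on f S" "holomorphic_several_on g S"
  shows "holomorphic_several_on (\<lambda>z. f z + g z) S"
  unfolding holomorphic_several_on_def
proof
  fix z assume z: "z \<in> S"
  obtain D where D: "(f has_derivative D) (at z within S)" "\<And>c w. D (c *s w) = c * D w"
    by (rule holomorphic_severalE[OF assms(1) z]) blast
  obtain E where E: "(g has_derivative E) (at z within S)" "\<And>c w. E (c *s w) = c * E w"
    by (rule holomorphic_severalE[OF assms(2) z]) blast
  show "\<exists>D. ((\<lambda>z. f z + g z) has_derivative D) (at z within S) \<and> (\<forall>c w. D (c *s w) = c * D w)"
    using has_derivative_add[OF D(1) E(1)]
    by (intro exI[of _ "\<lambda>w. D w + E w"]) (simp add: D(2) E(2) algebra_simps)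
qed

lemma holomorphic_several_mult:
  assumes "holomorphic_several_on f S" "holomorphic_several_on g S"
  shows "holomorphic_several_on (\<lambda>z. f z * g z) S"
  unfolding holomorphic_several_on_def
proof
  fix z assume z: "z \<in> S"
  obtain D where D: "(f has_derivative D) (at z within S)" "\<And>c w. D (c *s w) = c * D w"
    by (rule holomorphic_severalE[OF assms(1) z]) blast
  obtain E where E: "(g has_derivative E) (at z within S)" "\<And>c w. E (c *s w) = c * E w"
    by (rule holomorphic_severalE[OF assms(2) z]) blast
  show "\<exists>D. ((\<lambda>z. f z * g z) has_derivative D) (at z within S) \<and> (\<forall>c w. D (c *s w) = c * D w)"
    using has_derivative_mult[OF D(1) E(1)]
    by (intro exI[of _ "\<lambda>w. f z * E w + D w * g z"]) (simp add: D(2) E(2) algebra_simps)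
qed

lemma holomorphic_several_diff:
  assumes "holomorphic_several_on f S" "holomorphic_several_on g S"
  shows "holomorphic_several_on (\<lambda>z. f z - g z) S"
  using holomorphic_several_add[OF assms(1)
      holomorphic_several_mult[OF holomorphic_several_const[of "- 1"] assms(2)]] by simp

lemma holomorphic_several_compose:
  assumes "holomorphic_several_on f S" "\<And>z. z \<in> S \<Longrightarrow> (h has_field_derivative h' (f z)) (at (f z))"
  shows "holomorphic_several_on (\<lambda>z. h (f z)) S"
  unfolding holomorphic_several_on_def
proof
  fix z assume z: "z \<in> S"
  obtain D where D: "(f has_derivative D) (at z within S)" "\<And>c w. D (c *s w) = c * D w"
    by (rule holomorphic_severalE[OF assms(1) z]) blast
  show "\<exists>D. ((\<lambda>z. h (f z)) has_derivative D) (at z within S) \<and> (\<forall>c w. D (c *s w) = c * D w)"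
    using has_derivative_compose[OF D(1) assms(2)[OF z, unfolded has_field_derivative_def]]
    by (intro exI[of _ "\<lambda>w. h' (f z) * D w"]) (simp add: D(2))
qed

lemma holomorphic_several_sum:
  "(\<And>k. k \<in> K \<Longrightarrow> holomorphic_several_on (f k) S) \<Longrightarrow> holomorphic_several_on (\<lambda>z. \<Sum>k\<in>K. f k z) S"
  by (induction K rule: infinite_finite_induct)
    (auto intro: holomorphic_several_const holomorphic_several_add)

lemma holomorphic_several_prod:
  "(\<And>k. k \<in> K \<Longrightarrow> holomorphic_several_on (f k) S) \<Longrightarrow> holomorphic_several_on (\<lambda>z. \<Prod>k\<in>K. f k z) S"
  by (induction K rule: infinite_finite_induct)
    (auto intro: holomorphic_several_const holomorphic_several_mult)

lemma holomorphic_several_powi: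
  assumes "holomorphic_several_on f S" "\<And>z. z \<in> S \<Longrightarrow> f z \<noteq> 0"
  shows "holomorphic_several_on (\<lambda>z. f z powi n) S"
  by (rule holomorphic_several_compose[OF assms(1), where h' = "\<lambda>w. of_int n * w powi (n - 1)"])
    (use assms(2) in \<open>auto intro!: derivative_eq_intros\<close>)

section \<open>Convergence on the ordered domains\<close>

lemma locally_uniform_convergence_if_dominated:
  assumes cont: "continuous_on \<Omega> B"
    and dom: "\<And>y. y \<in> \<Omega> \<Longrightarrow> (\<lambda>n. norm (f n y)) summable_on UNIV \<and> (\<Sum>\<^sub>\<infinity>n. norm (f n y)) \<le> B y"
  shows "converges_abs_loc_unif_on f \<Omega>"
  unfolding converges_abs_loc_unif_on_def
proof
  fix x assume x: "x \<in> \<Omega>"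
  let ?U = "\<Omega> \<inter> B -` {..<B x + 1}"
  have "openin (top_of_set \<Omega>) ?U" by (rule continuous_openin_preimage_gen[OF cont]) simp
  moreover have "bdd_above ((\<lambda>y. \<Sum>\<^sub>\<infinity>n. norm (f n y)) ` ?U)"
    by (rule bdd_aboveI2[of _ _ "B x + 1"]) (use dom in force)
  ultimately show "\<exists>U. openin (top_of_set \<Omega>) U \<and> x \<in> U \<and>
        (\<forall>y\<in>U. (\<lambda>n. norm (f n y)) summable_on UNIV) \<and> bdd_above ((\<lambda>y. \<Sum>\<^sub>\<infinity>n. norm (f n y)) ` U)"
    using x dom by (intro exI[of _ ?U]) auto
qed

lemma bij_exponents: "bij (\<lambda>n i. - n i - 1 :: int)"
  by (rule bij_betwI[where g = "\<lambda>n i. - n i - 1"]) auto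

lemma correlator_term_eq:
  "correlator_term A \<sigma> v v' n z =
     v' (mode_product A (map \<sigma> (sorted_list_of_set UNIV)) (\<lambda>i. - n i - 1) v) * monomial (\<lambda>i. - n i - 1) z"
  by (simp add: correlator_term_def mode_product_def monomial_def foldr_map o_def)

text \<open>Recovers the relative position of two variables from the comparison of their absolute values.\<close>

lemma before_in_sorted:
  assumes "sorted_wrt R xs" "distinct xs" "i \<in> set xs" "j \<in> set xs" "i \<noteq> j" "\<not> R j i"
  obtains us ws where "xs = us @ i # ws" "j \<in> set ws"
proof -
  obtain us ws where eq: "xs = us @ i # ws" using assms(3) by (metis split_list)
  have "j \<notin> set us" using assms(1,6) by (auto simp: eq sorted_wrt_append)
  then have "j \<in> set ws" using assms(4,5) by (auto simp: eq)
  with eq show ?thesis by (rule that)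
qed

lemma Omega_norms_distinct:
  assumes \<sigma>: "\<sigma> permutes UNIV" and z: "z \<in> Omega \<sigma>" and ij: "i \<noteq> j"
  shows "norm (z $ i) \<noteq> norm (z $ j)"
proof -
  have pq: "\<sigma> (inv \<sigma> i) = i" "\<sigma> (inv \<sigma> j) = j" by (simp_all add: permutes_inverses[OF \<sigma>])
  then have "inv \<sigma> i \<noteq> inv \<sigma> j" using ij by metis
  then have "inv \<sigma> i < inv \<sigma> j \<or> inv \<sigma> j < inv \<sigma> i" by (rule neq_iff[THEN iffD1])
  moreover have less: "norm (z $ \<sigma> q) < norm (z $ \<sigma> p)" if "p < q" for p q
    using z that by (simp add: Omega_def)
  ultimately show ?thesis
    using less[of "inv \<sigma> i" "inv \<sigma> j"] less[of "inv \<sigma> j" "inv \<sigma> i"]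
    by (auto simp: pq)
qed

lemma has_sum_correlator_term:
  assumes "((\<lambda>a. v' (mode_product A (map \<sigma> (sorted_list_of_set UNIV)) a v) * monomial a z) has_sum s) UNIV"
  shows "((\<lambda>n. correlator_term A \<sigma> v v' n z) has_sum s) UNIV"
  unfolding correlator_term_eq
  using has_sum_reindex_bij_betw[OF bij_exponents,
      of "\<lambda>a. v' (mode_product A (map \<sigma> (sorted_list_of_set UNIV)) a v) * monomial a z"] assms
  by simp

lemma Omega_order:
  assumes "\<sigma> permutes UNIV" "z \<in> Omega \<sigma>"
  shows "sorted_wrt (\<lambda>i j. norm (z $ j) < norm (z $ i)) (map \<sigma> (sorted_list_of_set UNIV))"
proof -
  have "sorted_wrt (<) (sorted_list_of_set (UNIV :: 'a set))" by simp
  then show ?thesis unfolding sorted_wrt_map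
    by (rule sorted_wrt_mono_rel[rotated]) (use assms(2) in \<open>simp add: Omega_def\<close>)
qed

theorem theorem8p1:
  fixes smul :: "complex \<Rightarrow> 'v::ab_group_add \<Rightarrow> 'v"
    and V :: "nat \<Rightarrow> 'v set"
    and L0 :: "'v \<Rightarrow> 'v"
    and A :: "'m::{finite,linorder} \<Rightarrow> int \<Rightarrow> 'v \<Rightarrow> 'v"
  assumes "graded_vector_space smul V L0"
    and "\<And>i. homogeneous_field smul L0 (A i)"
    and "\<And>i j. i \<noteq> j \<Longrightarrow> local_fields (A i) (A j)"
  shows "\<exists>f :: 'v \<Rightarrow> ('v \<Rightarrow> complex) \<Rightarrow> complex ^ 'm::{finite,linorder} \<Rightarrow> complex.
    (\<forall>v. \<forall>v'\<in>graded_dual smul V.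
       holomorphic_several_on (f v v') (Conf (- {0})) \<and>
       (\<forall>\<sigma>. \<sigma> permutes UNIV \<longrightarrow>
          converges_abs_loc_unif_on (correlator_term A \<sigma> v v') (Omega \<sigma>) \<and>
          (\<forall>z\<in>Omega \<sigma>. ((\<lambda>n. correlator_term A \<sigma> v v' n z) has_sum f v v' z) UNIV))) \<and>
    (\<exists>N::nat. \<forall>v. \<forall>v'\<in>graded_dual smul V. \<exists>g.
       (\<forall>z\<in>Conf (- {0}). f v v' z * (\<Prod>(i, j)\<in>{(i, j). i < j}. (z $ i - z $ j) ^ N) = g z) \<and>
       holomorphic_several_on g punctured_space \<and>
       laurent_polynomial_fun g)"
proof -
  interpret graded_vector_space smul V L0 by (rule assms(1))
  have linear_A: "Vector_Spaces.linear smul smul (A i n)" for i n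
    using assms(2)[of i] by (simp add: homogeneous_field_def)
  have "\<forall>i. \<exists>\<Delta>::int. \<forall>n v. L0 (A i n v) - A i n (L0 v) = smul (of_int (\<Delta> - n - 1)) (A i n v)"
    using assms(2) unfolding homogeneous_field_def by blast
  then obtain \<Delta> :: "'m \<Rightarrow> int"
    where weight: "\<And>i n v. L0 (A i n v) - A i n (L0 v) = smul (of_int (\<Delta> i - n - 1)) (A i n v)"
    using choice[of "\<lambda>i (\<Delta>::int). \<forall>n v. L0 (A i n v) - A i n (L0 v) = smul (of_int (\<Delta> - n - 1)) (A i n v)"]
    by blast
  obtain M where M: "\<And>i j. i \<noteq> j \<Longrightarrow>
      (mult_z1_minus_z2 ^^ (M i j)) (commutator_series (A i) (A j)) = (\<lambda>a b v. 0)"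
    using assms(3) unfolding local_fields_def by metis
  \<comment> \<open>Finitely many pairs of fields, so one exponent works for all; it is chosen before \<open>v\<close> and \<open>v'\<close>.\<close>
  define N where "N = Max (range (case_prod M))"
  have loc: "(mult_z1_minus_z2 ^^ N) (commutator_series (A i) (A j)) = (\<lambda>a b v. 0)" if "i \<noteq> j" for i j
  proof (rule mult_z1_minus_z2_pow_mono[OF M[OF that]])
    show "M i j \<le> N" unfolding N_def by (rule Max_ge) (auto intro: range_eqI[of _ _ "(i, j)"])
  qed
  obtain ps :: "('m \<times> 'm) list" where ps: "distinct ps" "set ps = {(i, j). i < j}"
    using finite_distinct_list[of "{(i, j). i < (j::'m)}"] by auto
  \<comment> \<open>\<open>F\<close> uses the increasing order of the indices; by \<open>F_eq\<close> any other order gives the same series.\<close>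
  define C where "C xs v v' a = v' (mode_product A xs a v)" for xs v and v' :: "'v \<Rightarrow> complex" and a :: "'m \<Rightarrow> int"
  define F where "F v v' = mult_diffs (concat (map (replicate N) ps)) (C (sorted_list_of_set UNIV) v v')" for v v'
  define g where "g v v' z = (\<Sum>a | F v v' a \<noteq> 0. F v v' a * monomial a z)" for v v' z
  define D where "D z = (\<Prod>(i, j)\<in>{(i, j). i < j}. (z $ i - z $ j) ^ N)" for z :: "complex ^ 'm::{finite,linorder}"
  have F_eq: "F v v' = mult_diffs (concat (map (replicate N) ps)) (C xs v v')"
    if "v' \<in> graded_dual smul V" "distinct xs" "set xs = UNIV" for v v' xs
    unfolding F_def C_def
    by (rule correlator_common_numerator[OF linear_A loc that(1) ps(2) _ _ that(2,3)]) simp_all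
  have F_fin: "finite {a. F v v' a \<noteq> 0}" if "v' \<in> graded_dual smul V" for v v'
    unfolding F_def C_def
    by (rule finite_numerator[OF linear_A weight loc that ps(2)]) simp_all
  have D_nz: "D z \<noteq> 0" if "z \<in> Conf (- {0})" for z
    using that by (auto simp: D_def Conf_def prod_zero_iff)
  have hol_g: "holomorphic_several_on (g v v') S" if S: "S \<subseteq> punctured_space" for v v' S
    unfolding g_def monomial_def
    by (intro holomorphic_several_sum holomorphic_several_mult holomorphic_several_const
        holomorphic_several_prod holomorphic_several_powi holomorphic_several_coordinate)
      (use S in \<open>auto simp: punctured_space_def\<close>)
  have hol_D: "holomorphic_several_on D S" for S
  proof -
    have "holomorphic_several_on (\<lambda>z. (z $ i - z $ j) ^ N) S" for i j :: 'm
      by (rule holomorphic_several_compose[where h = "\<lambda>w. w ^ N" and h' = "\<lambda>w. of_nat N * w ^ (N - 1)",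
            OF holomorphic_several_diff[OF holomorphic_several_coordinate holomorphic_several_coordinate]])
        (auto intro!: derivative_eq_intros)
    then show ?thesis unfolding D_def case_prod_unfold
      by (intro holomorphic_several_prod) simp
  qed
  \<comment> \<open>The extension is \<open>g / D\<close>; the quotient is an integer power so that holomorphy of powers covers it.\<close>
  have hol_f: "holomorphic_several_on (\<lambda>z. g v v' z * D z powi (- 1)) (Conf (- {0}))" for v v'
    by (rule holomorphic_several_mult[OF hol_g holomorphic_several_powi[OF hol_D D_nz]])
      (auto simp: Conf_def punctured_space_def)
  have conv: "converges_abs_loc_unif_on (correlator_term A \<sigma> v v') (Omega \<sigma>) \<and>
      (\<forall>z\<in>Omega \<sigma>. ((\<lambda>n. correlator_term A \<sigma> v v' n z) has_sum g v v' z * D z powi (- 1)) UNIV)"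
    if v': "v' \<in> graded_dual smul V" and \<sigma>: "\<sigma> permutes UNIV" for v v' \<sigma>
  proof -
    define xs where "xs = map \<sigma> (sorted_list_of_set UNIV)"
    have xs: "distinct xs" "set xs = UNIV"
      using permutes_inj[OF \<sigma>] permutes_surj[OF \<sigma>] by (simp_all add: xs_def distinct_map)
    define B where "B z = (\<Sum>a | F v v' a \<noteq> 0. norm (F v v' a * monomial a z))
         / (\<Prod>(i, j)\<in>{(i, j). i < j}. \<bar>norm (z $ i) - norm (z $ j)\<bar> ^ N)" for z
    note sep = Omega_norms_distinct[OF \<sigma>]
    have nz: "z $ i \<noteq> 0" if "z \<in> Omega \<sigma>" for z i using that by (auto simp: Omega_def)
    have van: "vanishes_along i j (C xs v v')" if z: "z \<in> Omega \<sigma>" and ij: "norm (z $ j) < norm (z $ i)" for z i j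
    proof -
      have "i \<noteq> j" "\<not> norm (z $ i) < norm (z $ j)" using ij by auto
      then obtain us ws where eq: "xs = us @ i # ws" and j: "j \<in> set ws"
        using before_in_sorted[OF Omega_order[OF \<sigma> z, folded xs_def] xs(1), of i j] xs(2) by blast
      show ?thesis
        using correlator_vanishes_along[where A = A, OF linear_A weight v', of us i ws j v] xs(1) j
        unfolding C_def eq by blast
    qed
    note numerator = convergence_from_numerator[OF ps F_eq[OF v' xs] F_fin[OF v']]
    have num: "(\<lambda>a. norm (C xs v v' a * monomial a z)) summable_on UNIV"
        "(\<Sum>\<^sub>\<infinity>a. norm (C xs v v' a * monomial a z)) \<le> B z"
        "((\<lambda>a. C xs v v' a * monomial a z) has_sum g v v' z / D z) UNIV"
      if z: "z \<in> Omega \<sigma>" for z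
      unfolding B_def g_def D_def
      by (rule numerator; (rule nz[OF z] | (rule sep[OF z], assumption) | (rule van[OF z], assumption)))+
    have "continuous_on (Omega \<sigma>) B"
      unfolding B_def monomial_def case_prod_unfold
      by (intro continuous_intros) (use nz sep in \<open>auto simp: prod_zero_iff\<close>)
    then have "converges_abs_loc_unif_on (correlator_term A \<sigma> v v') (Omega \<sigma>)"
    proof (rule locally_uniform_convergence_if_dominated)
      fix z assume z: "z \<in> Omega \<sigma>"
      have "(\<lambda>n. norm (correlator_term A \<sigma> v v' n z))
          = (\<lambda>n. (\<lambda>a. norm (C xs v v' a * monomial a z)) (\<lambda>i. - n i - 1))"
        by (simp add: correlator_term_eq C_def xs_def)
      then show "(\<lambda>n. norm (correlator_term A \<sigma> v v' n z)) summable_on UNIV \<and>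
          (\<Sum>\<^sub>\<infinity>n. norm (correlator_term A \<sigma> v v' n z)) \<le> B z"
        using num(1,2)[OF z]
          summable_on_reindex_bij_betw[OF bij_exponents, of "\<lambda>a. norm (C xs v v' a * monomial a z)"]
          infsum_reindex_bij_betw[OF bij_exponents, of "\<lambda>a. norm (C xs v v' a * monomial a z)"]
        by simp
    qed
    moreover have "((\<lambda>n. correlator_term A \<sigma> v v' n z) has_sum g v v' z * D z powi (- 1)) UNIV"
      if z: "z \<in> Omega \<sigma>" for z
    proof (rule has_sum_correlator_term)
      show "((\<lambda>a. v' (mode_product A (map \<sigma> (sorted_list_of_set UNIV)) a v) * monomial a z)
          has_sum g v v' z * D z powi (- 1)) UNIV"
        using num(3)[OF z] by (simp add: C_def xs_def power_int_minus divide_inverse)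
    qed
    ultimately show ?thesis by blast
  qed
  have laurent: "laurent_polynomial_fun (g v v')" if "v' \<in> graded_dual smul V" for v v'
    unfolding laurent_polynomial_fun_def g_def monomial_def using F_fin[OF that] by blast
  have "g v v' z * D z powi (- 1) * D z = g v v' z" if "z \<in> Conf (- {0})" for v v' z
    using D_nz[OF that] by (simp add: power_int_minus)
  then have second: "\<exists>N::nat. \<forall>v. \<forall>v'\<in>graded_dual smul V. \<exists>h.
       (\<forall>z\<in>Conf (- {0}). g v v' z * D z powi (- 1) * (\<Prod>(i, j)\<in>{(i, j). i < j}. (z $ i - z $ j) ^ N) = h z) \<and>
       holomorphic_several_on h punctured_space \<and> laurent_polynomial_fun h"
    using hol_g laurent unfolding D_def by (intro exI[of _ N]) blast
  show ?thesis
    by (rule exI[of _ "\<lambda>v v' z. g v v' z * D z powi (- 1)"]) (use hol_f conv second in simp)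
qed

end
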